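(* For every integer $n \geq 1$, the Bernoulli number $B_{2n}$ and the Euler numbers $E_{2j}$ satisfy $$B_{2n} = \frac{2n}{2^{2n}(2^{2n}-1)}\,\sum_{j=0}^{n-1} \binom{2n-1}{2j}\, E_{2j}.$$
   Context: The Euler numbers $(E_n)_{n\ge 0}$ and the Bernoulli numbers $(B_n)_{n\ge 0}$ are the unique sequences of numbers satisfying $$\frac{2}{e^x+e^{-x}} = \sum_{n=0}^{\infty} \frac{E_n}{n!}\,x^n \quad\text{and}\quad \frac{x}{e^x-1} = \sum_{n=0}^{\infty} \frac{B_n}{n!}\,x^n .$$ *)

theory Defs
  imports Complex_Main "HOL-Computational_Algebra.Formal_Power_Series"
begin

text \<open>
  The generating functions are read as identities of formal power series, where
  \<^term>\<open>fps_exp c\<close> is the expansion of \<open>e\<^sup>c\<^sup>x\<close>.  The divisor \<open>e\<^sup>x - 1\<close> has zero constant term;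
  division of power series over a field first cancels the common power of \<open>x\<close>, so the
  quotient below is the expected one (see \<open>bernoulli_number_gf_mult\<close>).  With this convention
  the Bernoulli number of index 1 is \<open>-1/2\<close>.
\<close>

definition euler_gf :: "real fps" where
  "euler_gf = 2 / (fps_exp 1 + fps_exp (-1))"

definition bernoulli_gf :: "real fps" where
  "bernoulli_gf = fps_X / (fps_exp 1 - 1)"

definition euler_number :: "nat \<Rightarrow> real" where
  "euler_number n = fact n * fps_nth euler_gf n"

definition bernoulli_number :: "nat \<Rightarrow> real" where
  "bernoulli_number n = fact n * fps_nth bernoulli_gf n"

lemma euler_number_gf: "Abs_fps (\<lambda>n. euler_number n / fact n) = euler_gf"
  by (simp add: euler_number_def fps_eq_iff)

lemma bernoulli_number_gf: "Abs_fps (\<lambda>n. bernoulli_number n / fact n) = bernoulli_gf"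
  by (simp add: bernoulli_number_def fps_eq_iff)

lemma euler_number_gf_mult: "euler_gf * (fps_exp 1 + fps_exp (-1)) = 2"
proof -
  have "fps_nth (fps_exp 1 + fps_exp (-1) :: real fps) 0 \<noteq> 0"
    by simp
  then show ?thesis
    unfolding euler_gf_def by (simp add: fps_divide_unit inverse_mult_eq_1 mult.assoc)
qed

lemma bernoulli_number_gf_mult: "bernoulli_gf * (fps_exp 1 - 1) = fps_X"
proof -
  let ?f = "fps_exp 1 - 1 :: real fps"
  have sd: "subdegree ?f = 1"
    by (rule subdegreeI) auto
  then have "?f \<noteq> 0" by auto
  moreover have "subdegree ?f \<le> subdegree (fps_X :: real fps)"
    using sd by simp
  ultimately have "?f dvd fps_X"
    by (subst fps_dvd_iff) auto
  then show ?thesis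
    unfolding bernoulli_gf_def by simp
qed

end

theory Submission
  imports Defs
begin

text \<open>
  With \<open>b(y) = y/(e\<^sup>y - 1)\<close>, the identity \<open>1/(e\<^sup>y + 1) = 1/(e\<^sup>y - 1) - 2/(e\<^sup>2\<^sup>y - 1)\<close> at
  \<open>y = 2x\<close> gives \<open>x e\<^sup>x \<cdot> 2/(e\<^sup>x + e\<^sup>-\<^sup>x) = 2x - 2x/(e\<^sup>2\<^sup>x + 1) = 2x + b(4x) - b(2x)\<close>.
  The claim compares the coefficients of \<open>x\<^sup>2\<^sup>n\<close>, using that the odd Euler numbers vanish.
\<close>

text \<open>Substitution of \<open>c * x\<close> into the defining product; kept as a product so
  that no quotient of series has to be composed. Used at \<open>c = 2\<close> and
  \<open>c = 4\<close>.\<close>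

lemma bernoulli_gf_scaled_mult:
  "(bernoulli_gf oo (fps_const c * fps_X)) * (fps_exp c - 1) = fps_const c * fps_X"
proof -
  have "(bernoulli_gf * (fps_exp 1 - 1)) oo (fps_const c * fps_X) = fps_const c * fps_X"
    by (simp add: bernoulli_number_gf_mult)
  then show ?thesis
    by (simp add: fps_compose_mult_distrib fps_compose_sub_distrib)
qed

text \<open>The denominator \<open>?s\<close> is invariant under \<open>x\<close> to
  \<open>-x\<close>, so both sides have the same product with \<open>?s\<close>, which is nonzero
  and cancels.\<close>

lemma euler_gf_even: "euler_gf oo (fps_const (-1) * fps_X) = euler_gf"
proof -
  let ?s = "fps_exp 1 + fps_exp (-1) :: real fps"
  have "?s oo (fps_const (-1) * fps_X) = ?s"
    by (simp add: fps_compose_add_distrib del: fps_const_neg)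
  then have "(euler_gf oo (fps_const (-1) * fps_X)) * ?s
      = (euler_gf * ?s) oo (fps_const (-1) * fps_X)"
    by (simp add: fps_compose_mult_distrib del: fps_const_neg)
  also have "\<dots> = euler_gf * ?s"
    by (simp add: euler_number_gf_mult numeral_fps_const)
  finally have "(euler_gf oo (fps_const (-1) * fps_X)) * ?s = euler_gf * ?s" .
  moreover have "fps_nth ?s 0 \<noteq> 0"
    by simp
  then have "?s \<noteq> 0"
    by (metis fps_zero_nth)
  ultimately show ?thesis
    by simp
qed

lemma euler_number_odd: "odd k \<Longrightarrow> euler_number k = 0"
  using arg_cong[OF euler_gf_even, of "\<lambda>f. fps_nth f k"]
  by (simp add: euler_number_def fps_compose_linear del: fps_const_neg)

lemma euler_bernoulli_gf:
  "fps_X * (euler_gf * fps_exp 1) = fps_const 2 * fps_X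
     + (bernoulli_gf oo (fps_const 4 * fps_X)) - (bernoulli_gf oo (fps_const 2 * fps_X))"
proof -
  define e e' :: "real fps" where "e = fps_exp 1" and "e' = fps_exp (-1)"
  define b2 b4 where "b2 = bernoulli_gf oo (fps_const 2 * fps_X)"
    and "b4 = bernoulli_gf oo (fps_const 4 * fps_X)"
  have exp2: "fps_exp 2 = e * e" and exp4: "fps_exp 4 = e * e * (e * e)"
    by (simp_all add: e_def flip: fps_exp_add_mult)
  have inv: "e * e' = 1"
    by (simp add: e_def e'_def flip: fps_exp_add_mult)
  have euler: "euler_gf * (e + e') = 2"
    by (simp add: e_def e'_def euler_number_gf_mult)
  have b2: "b2 * (e * e - 1) = 2 * fps_X"
    using bernoulli_gf_scaled_mult[of 2] by (simp add: b2_def exp2 numeral_fps_const)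
  have b4: "b4 * (e * e * (e * e) - 1) = 4 * fps_X"
    using bernoulli_gf_scaled_mult[of 4] by (simp add: b4_def exp4 numeral_fps_const)
  \<comment> \<open>The factor is a common denominator, since
    \<open>e^4 - 1 = (e^2 - 1) * (e^2 + 1)\<close>. Multiplying \<open>euler\<close> by
    \<open>e\<close> gives \<open>euler_gf * (e^2 + 1) = 2 * e\<close>, and both sides become
    \<open>2 * x * e^2 * (e^2 - 1)\<close>.\<close>
  have "(fps_X * (euler_gf * e)) * (e * e * (e * e) - 1)
      = (2 * fps_X + b4 - b2) * (e * e * (e * e) - 1)"
    using inv euler b2 b4 by algebra
  \<comment> \<open>The constant term vanishes, so the coefficient of \<open>x\<close>, which is 4,
    is the witness.\<close>
  moreover have "fps_nth (fps_exp 4 - 1 :: real fps) 1 \<noteq> 0"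
    by simp
  then have "e * e * (e * e) - 1 \<noteq> 0"
    unfolding exp4 by (metis fps_zero_nth)
  ultimately show ?thesis
    by (simp add: e_def b2_def b4_def numeral_fps_const)
qed

lemma fps_nth_euler_gf_exp:
  "fps_nth (euler_gf * fps_exp 1) m = (\<Sum>k\<le>m. real (m choose k) * euler_number k) / fact m"
  unfolding fps_mult_nth sum_divide_distrib atLeast0AtMost
  by (intro sum.cong) (simp_all add: euler_number_def binomial_fact field_simps)

theorem theorem1p3:
  fixes n :: nat
  assumes "n \<ge> 1"
  shows "bernoulli_number (2 * n) =
    (2 * real n) / (2 ^ (2 * n) * (2 ^ (2 * n) - 1)) *
    (\<Sum>j = 0..n - 1. real ((2 * n - 1) choose (2 * j)) * euler_number (2 * j))"
proof -
  let ?g = "\<lambda>k. real ((2 * n - 1) choose k) * euler_number k"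
  let ?P = "2 ^ (2 * n) * (2 ^ (2 * n) - 1) :: real"
  let ?S = "\<Sum>j = 0..n - 1. ?g (2 * j)"
  have P_eq: "(4::real) ^ (2 * n) - 2 ^ (2 * n) = ?P"
    by (simp add: algebra_simps flip: power_mult_distrib)
  \<comment> \<open>As \<open>n \<ge> 1\<close>, the even indices up to \<open>2 * n - 1\<close> are
    exactly the doubles of \<open>0..n - 1\<close>.\<close>
  have "(\<Sum>k\<le>2 * n - 1. ?g k) = (\<Sum>k\<in>(*) 2 ` {0..n - 1}. ?g k)"
  proof (rule sum.mono_neutral_right)
    show "\<forall>k\<in>{..2 * n - 1} - (*) 2 ` {0..n - 1}. ?g k = 0"
    proof
      fix k assume k: "k \<in> {..2 * n - 1} - (*) 2 ` {0..n - 1}"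
      have "odd k"
      proof
        assume "even k"
        then obtain j where "k = 2 * j" ..
        with k assms show False by auto
      qed
      then show "?g k = 0" by (simp add: euler_number_odd)
    qed
  qed (use assms in auto)
  also have "\<dots> = ?S"
    by (simp add: sum.reindex inj_on_def)
  \<comment> \<open>The factor \<open>fps_X\<close> shifts the index \<open>2 * n - 1\<close> to
    \<open>2 * n\<close>.\<close>
  finally have "?S / fact (2 * n - 1) = fps_nth (fps_X * (euler_gf * fps_exp 1)) (2 * n)"
    using assms by (simp add: fps_nth_euler_gf_exp)
  \<comment> \<open>The term \<open>2 * x\<close> contributes nothing because
    \<open>2 * n \<ge> 2\<close>.\<close>
  also have "\<dots> = (4 ^ (2 * n) - 2 ^ (2 * n)) * fps_nth bernoulli_gf (2 * n)"
    using assms unfolding euler_bernoulli_gf by (simp add: fps_compose_linear left_diff_distrib)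
  also have "\<dots> = ?P * fps_nth bernoulli_gf (2 * n)"
    unfolding P_eq ..
  finally have S: "?S = fact (2 * n - 1) * (?P * fps_nth bernoulli_gf (2 * n))"
    by (simp only: nonzero_divide_eq_eq[OF fact_nonzero] mult.commute)
  have "(1::real) < 2 ^ (2 * n)"
    using assms by (intro one_less_power) simp_all
  then have P: "?P \<noteq> 0"
    by (auto dest: less_imp_neq)
  have "bernoulli_number (2 * n) = 2 * real n * fact (2 * n - 1) * fps_nth bernoulli_gf (2 * n)"
    using assms by (simp add: bernoulli_number_def fact_reduce[of "2 * n"])
  also have "\<dots> = 2 * real n / ?P * ?S"
    unfolding S times_divide_eq_left nonzero_eq_divide_eq[OF P] by (simp only: mult_ac)
  finally show ?thesis .
qed

end
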